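(* Every $PT$-matrix of type 1 that has finite multiplicative order is permutation similar to an alternating sign matrix.
   Context: An alternating sign matrix (ASM) is a square $(0,1,-1)$-matrix in which the non-zero entries of each row and each column alternate in sign, beginning and ending with $+1$. A $T$-block $T(i_1,j_1,i_2,j_2)$ (with $i_1\ne i_2$, $j_1\ne j_2$) is the $n\times n$ matrix with $1$ in positions $(i_1,j_1),(i_2,j_2)$, $-1$ in positions $(i_1,j_2),(i_2,j_1)$, $0$ elsewhere. A $PT$-matrix of type 1 is an $n\times n$ matrix $P+T$, where $P$ is a permutation matrix representing a single $n$-cycle and $T$ is a $T$-block whose non-zero positions are disjoint from the positions of the $1$'s of $P$. Matrices $A,B$ are permutation similar if $B=R^TAR$ for a permutation matrix $R$. *)

theory Defs
  imports "Jordan_Normal_Form.Matrix" "HOL-Combinatorics.Permutations" "HOL-Combinatorics.Orbits"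
begin

text \<open>
  All matrices are integer matrices; rows and columns of an \<open>n \<times> n\<close> matrix are
  indexed by \<open>0, \<dots>, n - 1\<close>, in their natural order.
\<close>

definition perm_mat :: "nat \<Rightarrow> (nat \<Rightarrow> nat) \<Rightarrow> int mat" where
  "perm_mat n p = mat n n (\<lambda>(i, j). if j = p i then 1 else 0)"

definition is_permutation_mat :: "nat \<Rightarrow> int mat \<Rightarrow> bool" where
  "is_permutation_mat n R \<longleftrightarrow> (\<exists>p. p permutes {..<n} \<and> R = perm_mat n p)"

text \<open>
  The single orbit covers the whole index set, so fixed points are excluded when \<open>n \<ge> 2\<close>.
\<close>

definition is_n_cycle_mat :: "nat \<Rightarrow> int mat \<Rightarrow> bool" where
  "is_n_cycle_mat n P \<longleftrightarrow>
     (\<exists>p. p permutes {..<n} \<and> cyclic_on p {..<n} \<and> P = perm_mat n p)"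

definition T_block :: "nat \<Rightarrow> nat \<Rightarrow> nat \<Rightarrow> nat \<Rightarrow> nat \<Rightarrow> int mat" where
  "T_block n i1 j1 i2 j2 = mat n n (\<lambda>(i, j).
     if (i, j) \<in> {(i1, j1), (i2, j2)} then 1
     else if (i, j) \<in> {(i1, j2), (i2, j1)} then -1
     else 0)"

definition is_T_block :: "nat \<Rightarrow> int mat \<Rightarrow> bool" where
  "is_T_block n T \<longleftrightarrow>
     (\<exists>i1 j1 i2 j2. i1 < n \<and> j1 < n \<and> i2 < n \<and> j2 < n \<and> i1 \<noteq> i2 \<and> j1 \<noteq> j2 \<and>
        T = T_block n i1 j1 i2 j2)"

definition PT_matrix_type1 :: "nat \<Rightarrow> int mat \<Rightarrow> bool" where
  "PT_matrix_type1 n A \<longleftrightarrow>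
     (\<exists>P T. is_n_cycle_mat n P \<and> is_T_block n T \<and>
        (\<forall>i<n. \<forall>j<n. T $$ (i, j) \<noteq> 0 \<longrightarrow> P $$ (i, j) \<noteq> 1) \<and>
        A = P + T)"

text \<open>
  Beginning and ending with \<open>+1\<close> presupposes that there is a non-zero entry, hence the
  non-emptiness condition.
\<close>

definition alternating_line :: "int vec \<Rightarrow> bool" where
  "alternating_line v \<longleftrightarrow>
     (let xs = filter (\<lambda>x. x \<noteq> 0) (list_of_vec v)
      in xs \<noteq> [] \<and> hd xs = 1 \<and> last xs = 1 \<and> successively (\<lambda>x y. sgn y = - sgn x) xs)"

definition alternating_sign_matrix :: "nat \<Rightarrow> int mat \<Rightarrow> bool" where
  "alternating_sign_matrix n A \<longleftrightarrow>
     A \<in> carrier_mat n n \<and>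
     (\<forall>i<n. \<forall>j<n. A $$ (i, j) \<in> {0, 1, -1}) \<and>
     (\<forall>i<n. alternating_line (row A i)) \<and>
     (\<forall>j<n. alternating_line (col A j))"

definition permutation_similar :: "nat \<Rightarrow> int mat \<Rightarrow> int mat \<Rightarrow> bool" where
  "permutation_similar n A B \<longleftrightarrow>
     (\<exists>R. is_permutation_mat n R \<and> B = transpose_mat R * A * R)"

definition finite_mult_order :: "nat \<Rightarrow> int mat \<Rightarrow> bool" where
  "finite_mult_order n A \<longleftrightarrow> (\<exists>k>0. A ^\<^sub>m k = 1\<^sub>m n)"

end

theory Submission
  imports Defs "Jordan_Normal_Form.Determinant"
begin

text \<open>
  Write \<open>a, b\<close> for the rows of the block and \<open>p c, p d\<close> for its columns, so that \<open>a, b, c, d\<close> are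
  distinct. Reordering the indices gives an alternating sign matrix as soon as the order is monotone
  along \<open>d, a, b, c\<close> (columns) and along \<open>p b, p c, p d, p a\<close> (rows, either direction). Two chains
  with at most two common points are always compatible: map the first one to \<open>0, 1, 2, 3\<close> and the
  second one affinely, matching the common points.

  If there are three common points, \<open>{a, b, c, d}\<close> is a run \<open>{s, p s, p (p s), p (p (p s))}\<close>, and
  then the order is infinite. Indeed, a matrix \<open>A\<close> of finite order preserves the positive definite
  form \<open>\<Sum>\<^sub>i (A\<^sup>T)\<^sup>i A\<^sup>i\<close>, so \<open>det (2 A - 1) det A = det (2 - A)\<close>. The permutation matrix \<open>P\<close> satisfies
  the same identity, and \<open>A - P\<close> has rank one, so the identity becomes a relation between a few
  powers of \<open>2\<close>, which holds only for \<open>n = 4\<close> and \<open>b = p (p a)\<close>; there \<open>A\<close> or \<open>- A\<close> has a Jordan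
  block for the eigenvalue \<open>1\<close>.
\<close>

section \<open>Determinants of low-rank perturbations\<close>

text \<open>Sylvester's identity: the block matrix with rows \<open>1, - U\<close> and
  \<open>V, 1\<close> factors into block triangular matrices in two ways, leaving
  \<open>1 + U * V\<close> or \<open>1 + V * U\<close> as the only non-trivial diagonal
  block.\<close>

lemma det_one_plus_mult_commute:
  fixes U V :: "'a :: idom mat"
  assumes U: "U \<in> carrier_mat n m" and V: "V \<in> carrier_mat m n"
  shows "det (1\<^sub>m n + U * V) = det (1\<^sub>m m + V * U)"
proof -
  have UV: "U * V \<in> carrier_mat n n" and VU: "V * U \<in> carrier_mat m m"
    and mU: "- U \<in> carrier_mat n m"
    using U V by auto
  have c1: "four_block_mat (1\<^sub>m n) (- U) (0\<^sub>m m n) (1\<^sub>m m) *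
      four_block_mat (1\<^sub>m n + U * V) (0\<^sub>m n m) V (1\<^sub>m m) =
      four_block_mat (1\<^sub>m n) (- U) V (1\<^sub>m m)"
    by (subst mult_four_block_mat[where ?n1.0 = n and ?n2.0 = m])
      (use U V UV in \<open>auto simp: uminus_mult_left_mat intro!: arg_cong4[where f = four_block_mat]\<close>)
  have c2: "four_block_mat (1\<^sub>m n) (0\<^sub>m n m) V (1\<^sub>m m) *
      four_block_mat (1\<^sub>m n) (- U) (0\<^sub>m m n) (1\<^sub>m m + V * U) =
      four_block_mat (1\<^sub>m n) (- U) V (1\<^sub>m m)"
    by (subst mult_four_block_mat[where ?n1.0 = n and ?n2.0 = m])
      (use U V VU in \<open>auto simp: uminus_mult_right_mat intro!: arg_cong4[where f = four_block_mat]\<close>)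
  have "det (1\<^sub>m n + U * V) = det (four_block_mat (1\<^sub>m n) (- U) (0\<^sub>m m n) (1\<^sub>m m) *
      four_block_mat (1\<^sub>m n + U * V) (0\<^sub>m n m) V (1\<^sub>m m))"
    using U V UV mU
    by (subst det_mult[where n = "n + m"])
      (auto simp: det_four_block_mat_lower_left_zero[where n = n and m = m]
        det_four_block_mat_upper_right_zero[where n = n and m = m])
  also have "\<dots> = det (four_block_mat (1\<^sub>m n) (0\<^sub>m n m) V (1\<^sub>m m) *
      four_block_mat (1\<^sub>m n) (- U) (0\<^sub>m m n) (1\<^sub>m m + V * U))"
    by (simp only: c1 c2)
  also have "\<dots> = det (1\<^sub>m m + V * U)"
    using U V VU mU
    by (subst det_mult[where n = "n + m"])
      (auto simp: det_four_block_mat_lower_left_zero[where n = n and m = m]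
        det_four_block_mat_upper_right_zero[where n = n and m = m])
  finally show ?thesis .
qed

text \<open>Factor out \<open>M\<close> and apply the preceding identity with inner dimension 1.
  Writing the perturbation as \<open>M * Y * V\<close> keeps inverses of \<open>M\<close> out: a
  caller supplies a solution \<open>Y\<close> of a linear system instead.\<close>

lemma det_rank_one_update:
  fixes M :: "'a :: idom mat"
  assumes M: "M \<in> carrier_mat n n" and Y: "Y \<in> carrier_mat n 1" and V: "V \<in> carrier_mat 1 n"
  shows "det (M + M * Y * V) = det M * (1 + (V * Y) $$ (0, 0))"
proof -
  have "M + M * Y * V = M * (1\<^sub>m n + Y * V)"
    using M Y V by (simp add: mult_add_distrib_mat[of _ n n _ n] assoc_mult_mat[OF M Y V])
  moreover have "det (1\<^sub>m n + Y * V) = 1 + (V * Y) $$ (0, 0)"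
    using Y V by (subst det_one_plus_mult_commute[OF Y V]) (simp add: det_single)
  ultimately show ?thesis
    using M Y V by (simp add: det_mult[of _ n])
qed

section \<open>Finite order and invariant quadratic forms\<close>

text \<open>Invariance gives \<open>(2 A - 1)^T Q A = 2 Q - Q A = Q (2 - A)\<close>; take
  determinants and cancel \<open>det Q\<close>. This is the self-reciprocity of the characteristic
  polynomial of an isometry, evaluated at 2.\<close>

lemma isometry_det_identity:
  fixes A Q :: "real mat"
  assumes A: "A \<in> carrier_mat n n" and Q: "Q \<in> carrier_mat n n" and "det Q \<noteq> 0"
    and inv: "transpose_mat A * Q * A = Q"
  shows "det (2 \<cdot>\<^sub>m A - 1\<^sub>m n) * det A = det (2 \<cdot>\<^sub>m 1\<^sub>m n - A)"
proof -
  let ?B = "2 \<cdot>\<^sub>m A - 1\<^sub>m n" and ?At = "transpose_mat A"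
  have C: "2 \<cdot>\<^sub>m 1\<^sub>m n - A \<in> carrier_mat n n"
    using A by auto
  have At: "?At \<in> carrier_mat n n" and B: "?B \<in> carrier_mat n n" and Bt: "transpose_mat ?B \<in> carrier_mat n n"
    using A by auto
  have "transpose_mat ?B = 2 \<cdot>\<^sub>m ?At - 1\<^sub>m n"
    using A by (intro eq_matI) auto
  then have "transpose_mat ?B * (Q * A) = 2 \<cdot>\<^sub>m ?At * (Q * A) - Q * A"
    using A Q At by (simp add: minus_mult_distrib_mat[of _ n n _ _ n])
  also have "\<dots> = 2 \<cdot>\<^sub>m Q - Q * A"
    using mult_smult_assoc_mat[OF At, of "Q * A" n 2] A Q inv
    by (simp only: mult_carrier_mat assoc_mult_mat[OF At Q A])
  also have "\<dots> = Q * (2 \<cdot>\<^sub>m 1\<^sub>m n - A)"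
    using A Q by (simp add: mult_minus_distrib_mat[of _ n n _ n] mult_smult_distrib[of _ n n _ n])
  finally have "det (transpose_mat ?B * (Q * A)) = det (Q * (2 \<cdot>\<^sub>m 1\<^sub>m n - A))"
    by simp
  then have "det ?B * (det Q * det A) = det Q * det (2 \<cdot>\<^sub>m 1\<^sub>m n - A)"
    using A Q Bt det_mult[OF Q C]
    by (simp add: det_mult[of _ n] det_transpose[OF B])
  then show ?thesis
    using \<open>det Q \<noteq> 0\<close> by simp
qed

text \<open>The invariant form is \<open>q k\<close>, the sum of \<open>(A^m)^T A^m\<close> over
  \<open>m < k\<close>. Passing from \<open>Q\<close> to \<open>A^T Q A\<close> shifts the summation
  range by one, and \<open>A^k = 1\<close> makes the term gained equal to the term lost.\<close>

lemma finite_order_det_identity: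
  fixes A :: "real mat"
  assumes A: "A \<in> carrier_mat n n" and "k > 0" and k: "A ^\<^sub>m k = 1\<^sub>m n"
  shows "det (2 \<cdot>\<^sub>m A - 1\<^sub>m n) * det A = det (2 \<cdot>\<^sub>m 1\<^sub>m n - A)"
proof -
  define g where "g m = transpose_mat (A ^\<^sub>m m) * A ^\<^sub>m m" for m
  define q where "q l = mat n n (\<lambda>ij. \<Sum>m<l. g m $$ ij)" for l
  have pow: "A ^\<^sub>m m \<in> carrier_mat n n" for m
    using A by simp
  have q: "q l \<in> carrier_mat n n" for l
    by (simp add: q_def)
  have g: "g l \<in> carrier_mat n n" for l
    using pow[of l] by (simp add: g_def)
  have qSuc: "q (Suc l) = q l + g l" for l
    using g[of l] by (intro eq_matI) (auto simp: q_def)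
  have step: "transpose_mat A * g m * A = g (Suc m)" for m
  proof -
    have "g (Suc m) = (transpose_mat A * transpose_mat (A ^\<^sub>m m)) * (A ^\<^sub>m m * A)"
      by (simp add: g_def transpose_mult[OF pow A])
    also have "\<dots> = transpose_mat A * transpose_mat (A ^\<^sub>m m) * A ^\<^sub>m m * A"
      using A pow[of m] by (subst assoc_mult_mat[of _ n n _ n _ n]) auto
    also have "transpose_mat A * transpose_mat (A ^\<^sub>m m) * A ^\<^sub>m m = transpose_mat A * g m"
      unfolding g_def using A pow[of m] by (subst assoc_mult_mat[of _ n n _ n _ n]) auto
    finally show ?thesis ..
  qed
  \<comment> \<open>Telescoping, with \<open>g 0\<close> moved to the left so that the induction
    needs no matrix subtraction.\<close>
  have shift: "transpose_mat A * q l * A + g 0 = q l + g l" for l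
  proof (induction l)
    case 0
    have "q 0 = 0\<^sub>m n n"
      by (intro eq_matI) (auto simp: q_def)
    then show ?case
      using A by simp
  next
    case (Suc l)
    have "transpose_mat A * q (Suc l) * A = transpose_mat A * q l * A + g (Suc l)"
      unfolding qSuc step[symmetric] using A q[of l] g[of l]
      by (simp add: mult_add_distrib_mat[of _ n n _ n] add_mult_distrib_mat[of _ n n _ _ n])
    then have "transpose_mat A * q (Suc l) * A + g 0 =
        (transpose_mat A * q l * A + g 0) + g (Suc l)"
      using A q[of l] g[of 0] g[of "Suc l"]
      by (intro eq_matI) auto
    then show ?case
      unfolding Suc qSuc by simp
  qed
  have gk: "g k = g 0"
    using k A by (simp add: g_def)
  have inv: "transpose_mat A * q k * A = q k"
  proof (rule eq_matI)
    fix i j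
    assume "i < dim_row (q k)" "j < dim_col (q k)"
    then have ij: "i < n" "j < n"
      using q[of k] by auto
    have X: "transpose_mat A * q k * A \<in> carrier_mat n n"
      using A q[of k] by auto
    show "(transpose_mat A * q k * A) $$ (i, j) = q k $$ (i, j)"
      using arg_cong[OF shift[of k, unfolded gk], of "\<lambda>M. M $$ (i, j)"] ij X q[of k] g[of 0]
      by (simp del: index_mult_mat add: index_add_mat)
  qed (use A q[of k] in auto)
  \<comment> \<open>The form at \<open>v\<close> is the sum of the squared norms of
    \<open>A^m v\<close>; its \<open>m = 0\<close> term alone forces \<open>v = 0\<close>, so
    \<open>q k\<close> is nonsingular.\<close>
  have "v = 0\<^sub>v n" if v: "v \<in> carrier_vec n" and "q k *\<^sub>v v = 0\<^sub>v n" for v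
  proof -
    have form: "v \<bullet> (q l *\<^sub>v v) = (\<Sum>m<l. (A ^\<^sub>m m *\<^sub>v v) \<bullet> (A ^\<^sub>m m *\<^sub>v v))" for l
    proof (induction l)
      case 0
      have "q 0 = 0\<^sub>m n n"
        by (intro eq_matI) (auto simp: q_def)
      then show ?case
        using v by (simp add: scalar_prod_def)
    next
      case (Suc l)
      have "v \<bullet> (g l *\<^sub>v v) = (transpose_mat (A ^\<^sub>m l) *\<^sub>v (A ^\<^sub>m l *\<^sub>v v)) \<bullet> v"
        using v pow[of l] unfolding g_def
        by (subst comm_scalar_prod[of _ n]) (auto simp: assoc_mult_mat_vec[of _ n n _ n])
      also have "\<dots> = (A ^\<^sub>m l *\<^sub>v v) \<bullet> (A ^\<^sub>m l *\<^sub>v v)"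
        using v pow[of l] by (subst transpose_vec_mult_scalar[of _ n n]) auto
      finally have "v \<bullet> (g l *\<^sub>v v) = (A ^\<^sub>m l *\<^sub>v v) \<bullet> (A ^\<^sub>m l *\<^sub>v v)" .
      then show ?case
        unfolding qSuc using Suc v q[of l] g[of l]
        by (simp add: add_mult_distrib_mat_vec[of _ n n] scalar_prod_add_distrib[of _ n])
    qed
    have nonneg: "w \<bullet> w \<ge> 0" for w :: "real vec"
      by (simp add: scalar_prod_def sum_nonneg)
    have "(\<Sum>m<k. (A ^\<^sub>m m *\<^sub>v v) \<bullet> (A ^\<^sub>m m *\<^sub>v v)) = 0"
      using form[of k] that by simp
    then have "(A ^\<^sub>m 0 *\<^sub>v v) \<bullet> (A ^\<^sub>m 0 *\<^sub>v v) = 0"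
      using \<open>k > 0\<close>
      by (intro sum_nonneg_0[where s = "{..<k}" and f = "\<lambda>m. (A ^\<^sub>m m *\<^sub>v v) \<bullet> (A ^\<^sub>m m *\<^sub>v v)"])
        (auto intro: nonneg)
    then have "v \<bullet> v = 0"
      using A v by simp
    then show ?thesis
      using v by (simp add: scalar_prod_def sum_nonneg_eq_0_iff) (auto intro!: eq_vecI)
  qed
  then have "det (q k) \<noteq> 0"
    using det_0_iff_vec_prod_zero[OF q] by blast
  then show ?thesis
    using isometry_det_identity[OF A q _ inv] by blast
qed

text \<open>\<open>x\<close> and \<open>y\<close> form a Jordan chain:
  \<open>A^m x = \<epsilon>^m (x + m y)\<close>. If \<open>A^k = 1\<close>, the action on
  \<open>y\<close> gives \<open>\<epsilon>^k = 1\<close>, and then the action on \<open>x\<close>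
  gives \<open>k y = 0\<close>.\<close>

lemma infinite_order_of_growth:
  fixes A :: "real mat"
  assumes A: "A \<in> carrier_mat n n" and x: "x \<in> carrier_vec n" and y: "y \<in> carrier_vec n"
    and "y \<noteq> 0\<^sub>v n" and \<epsilon>: "\<epsilon> * \<epsilon> = 1"
    and Ax: "A *\<^sub>v x = \<epsilon> \<cdot>\<^sub>v (x + y)" and Ay: "A *\<^sub>v y = \<epsilon> \<cdot>\<^sub>v y"
    and "k > 0"
  shows "A ^\<^sub>m k \<noteq> 1\<^sub>m n"
proof
  assume k: "A ^\<^sub>m k = 1\<^sub>m n"
  have pow: "A ^\<^sub>m m \<in> carrier_mat n n" for m
    using A by simp
  have powy: "A ^\<^sub>m m *\<^sub>v y = \<epsilon> ^ m \<cdot>\<^sub>v y" for m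
  proof (induction m)
    case (Suc m)
    have "A ^\<^sub>m Suc m *\<^sub>v y = A ^\<^sub>m m *\<^sub>v (\<epsilon> \<cdot>\<^sub>v y)"
      using assoc_mult_mat_vec[OF pow A y] Ay by simp
    then show ?case
      using Suc y by (simp add: mult_mat_vec[OF pow] smult_smult_assoc mult.commute)
  qed (use A y in simp)
  have powx: "A ^\<^sub>m m *\<^sub>v x = \<epsilon> ^ m \<cdot>\<^sub>v (x + real m \<cdot>\<^sub>v y)" for m
  proof (induction m)
    case (Suc m)
    have "A ^\<^sub>m Suc m *\<^sub>v x = A ^\<^sub>m m *\<^sub>v (\<epsilon> \<cdot>\<^sub>v (x + y))"
      using assoc_mult_mat_vec[OF pow A x] Ax by simp
    also have "\<dots> = \<epsilon> \<cdot>\<^sub>v (A ^\<^sub>m m *\<^sub>v x + A ^\<^sub>m m *\<^sub>v y)"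
      using x y by (simp add: mult_mat_vec[OF pow] mult_add_distrib_mat_vec[OF pow x y])
    finally show ?case
      using x y unfolding Suc powy by (intro eq_vecI) (auto simp: algebra_simps)
  qed (use A x y in \<open>auto\<close>)
  obtain i where i: "i < n" "y $ i \<noteq> 0"
    using y \<open>y \<noteq> 0\<^sub>v n\<close> by (metis carrier_vecD eq_vecI index_zero_vec(1) index_zero_vec(2))
  have xk: "x = \<epsilon> ^ k \<cdot>\<^sub>v (x + real k \<cdot>\<^sub>v y)"
    using powx[of k, unfolded k one_mult_mat_vec[OF x]] .
  have "y = \<epsilon> ^ k \<cdot>\<^sub>v y"
    using powy[of k, unfolded k one_mult_mat_vec[OF y]] .
  then have "y $ i = (\<epsilon> ^ k \<cdot>\<^sub>v y) $ i"
    by (rule arg_cong)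
  also have "\<dots> = \<epsilon> ^ k * y $ i"
    using i y by simp
  finally have "\<epsilon> ^ k = 1"
    using i by simp
  have "x $ i = (\<epsilon> ^ k \<cdot>\<^sub>v (x + real k \<cdot>\<^sub>v y)) $ i"
    using xk by (rule arg_cong)
  also have "\<dots> = x $ i + real k * y $ i"
    using x y i \<open>\<epsilon> ^ k = 1\<close> by simp
  finally have "real k * y $ i = 0"
    by linarith
  then show False
    using i \<open>k > 0\<close> by simp
qed

section \<open>Enumeration of an n-cycle\<close>

text \<open>The first return time \<open>?m\<close> to \<open>s\<close> counts the orbit without
  repetition, and the orbit is all of \<open>{..<n}\<close>, so \<open>?m = n\<close>.\<close>

lemma cyclic_on_enum:
  assumes p: "p permutes {..<n :: nat}" and cyc: "cyclic_on p {..<n}" and s: "s < n"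
  shows "bij_betw (\<lambda>k. (p ^^ k) s) {..<n} {..<n}" and "(p ^^ n) s = s"
proof -
  let ?m = "funpow_dist1 p s s"
  have orb: "orbit p s = {..<n}"
    using orbit_cyclic_eq3[OF cyc] s by simp
  then have self: "s \<in> orbit p s"
    using s by simp
  have inj: "inj_on (\<lambda>k. (p ^^ k) s) {0..<?m}"
    by (rule inj_on_funpow_dist1[OF self])
  have img: "(\<lambda>k. (p ^^ k) s) ` {0..<?m} = {..<n}"
    using orbit_conv_funpow_dist1[OF self] orb by simp
  have m: "?m = n"
    using card_image[OF inj] img by simp
  show "bij_betw (\<lambda>k. (p ^^ k) s) {..<n} {..<n}"
    using inj img unfolding bij_betw_def m by (simp add: lessThan_atLeast0)
  show "(p ^^ n) s = s"
    using funpow_dist1_prop[OF self] unfolding m .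
qed

section \<open>PT-matrices as rank-one perturbations of permutation matrices\<close>

text \<open>The block is the rank-one matrix \<open>(e_a - e_b) (e_(p c) - e_(p d))^T\<close>. Its
  columns are written as images under \<open>p\<close> so that the conditions on the block become
  distinctness of \<open>a, b, c, d\<close>; the entry type is generic because both integer and real
  versions occur.\<close>

definition pt_mat :: "nat \<Rightarrow> (nat \<Rightarrow> nat) \<Rightarrow> nat \<Rightarrow> nat \<Rightarrow> nat \<Rightarrow> nat \<Rightarrow> 'a :: comm_ring_1 mat" where
  "pt_mat n p a b c d = mat n n (\<lambda>(i, j). of_bool (j = p i) +
     (of_bool (i = a) - of_bool (i = b)) * (of_bool (j = p c) - of_bool (j = p d)))"

lemma pt_mat_carrier [simp]: "pt_mat n p a b c d \<in> carrier_mat n n"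
  by (simp add: pt_mat_def)

lemma map_mat_pt_mat: "map_mat real_of_int (pt_mat n p a b c d) = pt_mat n p a b c d"
  by (intro eq_matI) (auto simp: pt_mat_def)

text \<open>Passes to the reals, where the arguments with positive definite forms and division take
  place.\<close>

lemma finite_mult_order_pt_mat:
  assumes "finite_mult_order n (pt_mat n p a b c d)"
  obtains k where "k > 0" "(pt_mat n p a b c d :: real mat) ^\<^sub>m k = 1\<^sub>m n"
proof -
  obtain k where k: "k > 0" "(pt_mat n p a b c d :: int mat) ^\<^sub>m k = 1\<^sub>m n"
    using assms by (auto simp: finite_mult_order_def)
  then have "map_mat real_of_int (pt_mat n p a b c d ^\<^sub>m k) = map_mat real_of_int (1\<^sub>m n)"
    by simp
  then have "(pt_mat n p a b c d :: real mat) ^\<^sub>m k = 1\<^sub>m n"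
    by (simp add: of_int_hom.mat_hom_pow[OF pt_mat_carrier] of_int_hom.mat_hom_one map_mat_pt_mat)
  with k that show ?thesis
    by blast
qed

lemma pt_mat_mult_vec:
  fixes f :: "nat \<Rightarrow> 'a :: comm_ring_1"
  assumes p: "p permutes {..<n}" and "i < n" "c < n" "d < n"
  shows "(pt_mat n p a b c d *\<^sub>v vec n f) $ i =
    f (p i) + (of_bool (i = a) - of_bool (i = b)) * (f (p c) - f (p d))"
proof -
  have lt: "p k < n" if "k < n" for k
    using permutes_in_image[OF p, of k] that by simp
  have del: "(\<Sum>j<n. of_bool (j = k) * f j) = f k" if "k < n" for k
    using that by (simp add: of_bool_def if_distrib[of "\<lambda>x. x * _"] cong: if_cong)
  define u :: 'a where "u = of_bool (i = a) - of_bool (i = b)"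
  have "(pt_mat n p a b c d *\<^sub>v vec n f) $ i =
      (\<Sum>j<n. (of_bool (j = p i) + u * (of_bool (j = p c) - of_bool (j = p d))) * f j)"
    using \<open>i < n\<close> by (simp add: pt_mat_def scalar_prod_def lessThan_atLeast0 u_def)
  also have "\<dots> = (\<Sum>j<n. of_bool (j = p i) * f j +
      u * (of_bool (j = p c) * f j - of_bool (j = p d) * f j))"
    by (simp only: distrib_right left_diff_distrib mult.assoc)
  also have "\<dots> = (\<Sum>j<n. of_bool (j = p i) * f j) +
      u * ((\<Sum>j<n. of_bool (j = p c) * f j) - (\<Sum>j<n. of_bool (j = p d) * f j))"
    by (simp only: sum.distrib sum_distrib_left[symmetric] sum_subtractf)
  finally show ?thesis
    using assms by (simp only: del lt u_def)
qed

text \<open>With \<open>u = e_a - e_b\<close>, the hypotheses say \<open>(2 - P) y = u\<close> and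
  \<open>(2 P - 1) z = u\<close>. Rank-one updates then compare \<open>2 - A\<close> with
  \<open>2 - P\<close>, \<open>2 A - 1\<close> with \<open>2 P - 1\<close> and \<open>A\<close> with
  \<open>P\<close>; dividing the determinant identity for \<open>A\<close> by that for
  \<open>P\<close> leaves a scalar relation.\<close>

lemma finite_order_resolvent_identity:
  fixes y z :: "nat \<Rightarrow> real"
  assumes p: "p permutes {..<n}"
    and lt: "a < n" "b < n" "c < n" "d < n"
    and ne: "a \<noteq> c" "a \<noteq> d" "b \<noteq> c" "b \<noteq> d"
    and fin: "finite_mult_order n (pt_mat n p a b c d)"
    and y: "\<And>i. i < n \<Longrightarrow> 2 * y i - y (p i) = of_bool (i = a) - of_bool (i = b)"
    and z: "\<And>i. i < n \<Longrightarrow> 2 * z (p i) - z i = of_bool (i = a) - of_bool (i = b)"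
  shows "y (p d) - y (p c) = 2 * (z (p c) - z (p d))"
proof -
  define u :: "nat \<Rightarrow> real" where "u i = of_bool (i = a) - of_bool (i = b)" for i
  define v :: "nat \<Rightarrow> real" where "v j = of_bool (j = p c) - of_bool (j = p d)" for j
  define P :: "real mat" where "P = mat n n (\<lambda>(i, j). of_bool (j = p i))"
  define V where "V = mat 1 n (\<lambda>(_, j). v j)"
  let ?q = "Hilbert_Choice.inv p"
  let ?A = "pt_mat n p a b c d :: real mat" and ?col = "\<lambda>f. mat n 1 (\<lambda>(i, _). f i) :: real mat"
  have plt: "p k < n" if "k < n" for k
    using permutes_in_image[OF p, of k] that by simp
  have P: "P \<in> carrier_mat n n" and V: "V \<in> carrier_mat 1 n" and col: "?col f \<in> carrier_mat n 1" for f
    by (auto simp: P_def V_def)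
  have del: "(\<Sum>j<n. of_bool (j = k) * f j) = f k" if "k < n" for k and f :: "nat \<Rightarrow> real"
    using that by (simp add: of_bool_def if_distrib[of "\<lambda>x. x * _"] cong: if_cong)
  have Pcol: "P * ?col f = ?col (\<lambda>i. f (p i))" for f
    by (intro eq_matI) (auto simp: P_def scalar_prod_def del plt lessThan_atLeast0[symmetric])
  have Vcol: "(V * ?col f) $$ (0, 0) = f (p c) - f (p d)" for f
    using lt by (simp add: V_def v_def scalar_prod_def del plt lessThan_atLeast0[symmetric]
        left_diff_distrib sum_subtractf)
  have colV: "(?col f * V) = mat n n (\<lambda>(i, j). f i * v j)" for f
    by (intro eq_matI) (auto simp: V_def scalar_prod_def)
  have "(2 \<cdot>\<^sub>m 1\<^sub>m n - P) * ?col f = 2 \<cdot>\<^sub>m ?col f - P * ?col f" for f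
    by (subst minus_mult_distrib_mat[OF _ P col], simp, subst mult_smult_assoc_mat[OF one_carrier_mat[of n] col])
      (simp_all add: left_mult_one_mat[OF col] del: One_nat_def)
  moreover have "u i = 2 * y i - y (p i)" "2 * u i = 2 * (2 * z (p i) - z i)" if "i < n" for i
    using y z that by (simp_all add: u_def)
  note u_eq = this
  ultimately have Y: "(2 \<cdot>\<^sub>m 1\<^sub>m n - P) * ?col (\<lambda>i. - y i) = ?col (\<lambda>i. - u i)"
    unfolding Pcol by (intro eq_matI) (simp_all add: u_eq(1))
  have "(2 \<cdot>\<^sub>m P - 1\<^sub>m n) * ?col f = 2 \<cdot>\<^sub>m (P * ?col f) - ?col f" for f
    by (simp only: minus_mult_distrib_mat[OF smult_carrier_mat[OF P] one_carrier_mat col]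
        mult_smult_assoc_mat[OF P col] left_mult_one_mat[OF col])
  then have Z: "(2 \<cdot>\<^sub>m P - 1\<^sub>m n) * ?col (\<lambda>i. 2 * z i) = ?col (\<lambda>i. 2 * u i)"
    unfolding Pcol by (intro eq_matI) (simp_all add: u_eq(2))
  have W: "P * ?col (\<lambda>i. u (?q i)) = ?col u"
    using permutes_inverses[OF p] by (simp add: Pcol del: One_nat_def)
  have "det (2 \<cdot>\<^sub>m 1\<^sub>m n - ?A) = det ((2 \<cdot>\<^sub>m 1\<^sub>m n - P) + (2 \<cdot>\<^sub>m 1\<^sub>m n - P) * ?col (\<lambda>i. - y i) * V)"
    unfolding Y colV by (rule arg_cong[of _ _ det], intro eq_matI) (auto simp: pt_mat_def P_def u_def v_def)
  also have "\<dots> = det (2 \<cdot>\<^sub>m 1\<^sub>m n - P) * (1 + (y (p d) - y (p c)))"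
    using P V by (subst det_rank_one_update[where n = n]) (auto simp: Vcol simp del: index_mult_mat One_nat_def)
  finally have detY: "det (2 \<cdot>\<^sub>m 1\<^sub>m n - ?A) = det (2 \<cdot>\<^sub>m 1\<^sub>m n - P) * (1 + (y (p d) - y (p c)))" .
  have "det (2 \<cdot>\<^sub>m ?A - 1\<^sub>m n) = det ((2 \<cdot>\<^sub>m P - 1\<^sub>m n) + (2 \<cdot>\<^sub>m P - 1\<^sub>m n) * ?col (\<lambda>i. 2 * z i) * V)"
    unfolding Z colV by (rule arg_cong[of _ _ det], intro eq_matI) (auto simp: pt_mat_def P_def u_def v_def)
  also have "\<dots> = det (2 \<cdot>\<^sub>m P - 1\<^sub>m n) * (1 + 2 * (z (p c) - z (p d)))"
    using P V by (subst det_rank_one_update[where n = n]) (auto simp: Vcol simp del: index_mult_mat One_nat_def)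
  finally have detZ: "det (2 \<cdot>\<^sub>m ?A - 1\<^sub>m n) = det (2 \<cdot>\<^sub>m P - 1\<^sub>m n) * (1 + 2 * (z (p c) - z (p d)))" .
  \<comment> \<open>\<open>u\<close> vanishes at \<open>c\<close> and \<open>d\<close>, so the
    correction factor is 1.\<close>
  have "det ?A = det (P + P * ?col (\<lambda>i. u (?q i)) * V)"
    unfolding W colV by (rule arg_cong[of _ _ det], intro eq_matI) (auto simp: pt_mat_def P_def u_def v_def)
  also have "\<dots> = det P"
    using P V ne permutes_inverses[OF p]
    by (subst det_rank_one_update[where n = n]) (auto simp: Vcol u_def simp del: index_mult_mat One_nat_def)
  finally have detA: "det ?A = det P" .
  \<comment> \<open>\<open>P\<close> is orthogonal, so the identity matrix serves as its invariant
    form.\<close>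
  have "transpose_mat P * 1\<^sub>m n * P = 1\<^sub>m n"
  proof (rule eq_matI)
    fix i j
    assume "i < dim_row (1\<^sub>m n :: real mat)" "j < dim_col (1\<^sub>m n :: real mat)"
    then have ij: "i < n" "j < n" by auto
    have "(transpose_mat P * 1\<^sub>m n * P) $$ (i, j) = (\<Sum>k<n. of_bool (i = p k) * of_bool (j = p k))"
      using P ij by (simp add: P_def scalar_prod_def lessThan_atLeast0)
    also have "\<dots> = (\<Sum>k<n. of_bool (k = ?q i) * of_bool (j = p k))"
      by (intro sum.cong) (auto simp: permutes_inverses[OF p])
    also have "\<dots> = of_bool (j = i)"
      using ij permutes_in_image[OF permutes_inv[OF p], of i]
      by (subst del) (auto simp: permutes_inverses[OF p])
    finally show "(transpose_mat P * 1\<^sub>m n * P) $$ (i, j) = 1\<^sub>m n $$ (i, j)"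
      using ij by auto
  qed (use P in auto)
  then have detP: "det (2 \<cdot>\<^sub>m P - 1\<^sub>m n) * det P = det (2 \<cdot>\<^sub>m 1\<^sub>m n - P)"
    using isometry_det_identity[OF P, of "1\<^sub>m n"] by simp
  \<comment> \<open>An eigenvector for 2 would double along \<open>p\<close>, which is impossible at
    an index where its absolute value is maximal.\<close>
  have nz: "det (2 \<cdot>\<^sub>m 1\<^sub>m n - P) \<noteq> 0"
  proof
    assume "det (2 \<cdot>\<^sub>m 1\<^sub>m n - P) = 0"
    moreover have "2 \<cdot>\<^sub>m 1\<^sub>m n - P \<in> carrier_mat n n"
      using P by auto
    ultimately obtain w where w: "w \<in> carrier_vec n" "w \<noteq> 0\<^sub>v n" and
      0: "(2 \<cdot>\<^sub>m 1\<^sub>m n - P) *\<^sub>v w = 0\<^sub>v n"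
      by (meson det_0_iff_vec_prod_zero)
    have eigen: "2 * w $ i = w $ p i" if "i < n" for i
    proof -
      have "0 = ((2 \<cdot>\<^sub>m 1\<^sub>m n - P) *\<^sub>v w) $ i"
        using 0 that by simp
      also have "\<dots> = (\<Sum>j<n. 2 * (of_bool (j = i) * w $ j) - of_bool (j = p i) * w $ j)"
        using that w by (auto simp: P_def scalar_prod_def lessThan_atLeast0 algebra_simps intro!: sum.cong)
      also have "\<dots> = 2 * w $ i - w $ p i"
        using that by (simp add: sum_subtractf sum_distrib_left[symmetric] del plt)
      finally show ?thesis by simp
    qed
    obtain j where j: "j < n" "w $ j \<noteq> 0"
      using w by (metis carrier_vecD eq_vecI index_zero_vec(1) index_zero_vec(2))
    then have "finite ((\<lambda>i. \<bar>w $ i\<bar>) ` {..<n})" "(\<lambda>i. \<bar>w $ i\<bar>) ` {..<n} \<noteq> {}"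
      by auto
    from Max_in[OF this] obtain i where i: "i < n" and
      "\<bar>w $ i\<bar> = Max ((\<lambda>i. \<bar>w $ i\<bar>) ` {..<n})"
      by auto
    then have max: "\<bar>w $ k\<bar> \<le> \<bar>w $ i\<bar>" if "k < n" for k
      using that by simp
    then show False
      using max[OF plt[OF i]] max[OF j(1)] j eigen[OF i] by linarith
  qed
  obtain k where "k > 0" "?A ^\<^sub>m k = 1\<^sub>m n"
    using fin by (rule finite_mult_order_pt_mat)
  then have "det (2 \<cdot>\<^sub>m ?A - 1\<^sub>m n) * det ?A = det (2 \<cdot>\<^sub>m 1\<^sub>m n - ?A)"
    by (intro finite_order_det_identity) auto
  then have "det (2 \<cdot>\<^sub>m P - 1\<^sub>m n) * det P * (1 + 2 * (z (p c) - z (p d))) =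
      det (2 \<cdot>\<^sub>m 1\<^sub>m n - P) * (1 + (y (p d) - y (p c)))"
    unfolding detA detY detZ by (simp add: mult_ac)
  then show ?thesis
    using nz unfolding detP by simp
qed

section \<open>The determinant identity in explicit powers of 2\<close>

text \<open>
  Up to the factor \<open>2 ^ n - 1\<close>, these are the entries of \<open>(2 - P)\<^sup>-\<^sup>1\<close> and \<open>(2 P - 1)\<^sup>-\<^sup>1\<close> in column \<open>m\<close>
  and row \<open>l\<close>, where \<open>P\<close> is the matrix of the cycle \<open>l \<mapsto> l + 1\<close> modulo \<open>n\<close>.
\<close>

definition fwd_res :: "nat \<Rightarrow> nat \<Rightarrow> nat \<Rightarrow> real" where
  "fwd_res n m l = (if l \<le> m then 2 ^ (n - 1 - m + l) else 2 ^ (l - m - 1))"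

definition bwd_res :: "nat \<Rightarrow> nat \<Rightarrow> nat \<Rightarrow> real" where
  "bwd_res n m l = (if l \<le> m then 2 ^ (m - l) else 2 ^ (n + m - l))"

text \<open>Along the cycle the values double, from 1 just after \<open>m\<close> up to
  \<open>2 ^ (n - 1)\<close> at \<open>m\<close>; only the drop from \<open>m\<close> to its
  successor leaves the residue \<open>2 ^ n - 1\<close>.\<close>

lemma fwd_res_step:
  assumes "m < n" "l < n"
  shows "2 * fwd_res n m l - fwd_res n m (Suc l mod n) = (2 ^ n - 1) * of_bool (l = m)"
proof -
  obtain r where r: "n = Suc (m + r)"
    using assms less_iff_Suc_add by blast
  consider "l \<le> m" | "l > m" "Suc l < n" | "l > m" "Suc l = n"
    using assms by linarith
  then show ?thesis
  proof cases
    case 1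
    then show ?thesis
      by (cases "l = m") (auto simp: fwd_res_def r power_add mod_Suc)
  next
    case 2
    then have "l - m = Suc (l - Suc m)" by simp
    then show ?thesis using 2 by (simp add: fwd_res_def)
  next
    case 3
    then have "n - Suc m = Suc (l - Suc m)" by simp
    then show ?thesis using 3 by (simp add: fwd_res_def)
  qed
qed

text \<open>Here the values halve, from \<open>2 ^ (n - 1)\<close> just after \<open>m\<close> down
  to 1 at \<open>m\<close>, and only the jump after \<open>m\<close> leaves a residue.\<close>

lemma bwd_res_step:
  assumes "m < n" "l < n"
  shows "2 * bwd_res n m (Suc l mod n) - bwd_res n m l = (2 ^ n - 1) * of_bool (l = m)"
proof -
  consider "l < m" | "l = m" | "l > m" "Suc l < n" | "l > m" "Suc l = n"
    using assms by linarith
  then show ?thesis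
  proof cases
    case 1
    then have "m - l = Suc (m - Suc l)" by simp
    then show ?thesis using 1 assms by (simp add: bwd_res_def)
  next
    case 2
    then show ?thesis
      using assms by (cases "Suc l = n") (auto simp: bwd_res_def simp flip: power_Suc)
  next
    case 3
    then have "n + m - l = Suc (n + m - Suc l)" by simp
    then show ?thesis using 3 by (simp add: bwd_res_def)
  next
    case 4
    then have "n + m - l = Suc m" by simp
    then show ?thesis using 4 by (simp add: bwd_res_def)
  qed
qed

text \<open>Provides coordinates in which \<open>p\<close> is addition of 1 modulo \<open>n\<close>,
  the form the resolvents are written for.\<close>

lemma cyclic_position:
  assumes p: "p permutes {..<n :: nat}" and cyc: "cyclic_on p {..<n}" and s: "s < n"
  obtains pos where "\<And>i. i < n \<Longrightarrow> pos i < n" "\<And>i. i < n \<Longrightarrow> (p ^^ pos i) s = i"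
    "\<And>k. k < n \<Longrightarrow> pos ((p ^^ k) s) = k" "\<And>i. i < n \<Longrightarrow> pos (p i) = Suc (pos i) mod n"
proof -
  note enum = cyclic_on_enum[OF assms]
  define pos where "pos = inv_into {..<n} (\<lambda>k. (p ^^ k) s)"
  have lt: "pos i < n" and at: "(p ^^ pos i) s = i" if "i < n" for i
  proof -
    have "i \<in> (\<lambda>k. (p ^^ k) s) ` {..<n}"
      using enum(1) that by (simp add: bij_betw_def)
    from inv_into_into[OF this] f_inv_into_f[OF this] show "pos i < n" "(p ^^ pos i) s = i"
      by (auto simp: pos_def)
  qed
  have pos: "pos ((p ^^ k) s) = k" if "k < n" for k
    unfolding pos_def using enum(1) that by (intro inv_into_f_f) (auto simp: bij_betw_def)
  have "pos (p i) = Suc (pos i) mod n" if "i < n" for i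
  proof -
    have "p i = (p ^^ Suc (pos i)) s"
      using at[OF that] by simp
    also have "\<dots> = (p ^^ (Suc (pos i) mod n)) s"
      using funpow_mod_eq[OF enum(2)] by metis
    finally show ?thesis
      using pos that by (metis mod_less_divisor gr_zeroI not_less_zero)
  qed
  with lt at pos that show ?thesis by blast
qed

text \<open>Here \<open>a, b, c, d\<close> are positions counted from \<open>s\<close>, and
  \<open>u, v\<close> are the positions of the two block columns. The resolvent differences, divided
  by \<open>2 ^ n - 1\<close>, solve the two linear systems; clearing that denominator leaves a
  relation between powers of 2.\<close>

lemma finite_order_position_identity:
  assumes p: "p permutes {..<n :: nat}" and cyc: "cyclic_on p {..<n}" and s: "s < n"
    and lt: "a < n" "b < n" "c < n" "d < n"
    and ne: "a \<noteq> c" "a \<noteq> d" "b \<noteq> c" "b \<noteq> d"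
    and fin: "finite_mult_order n
      (pt_mat n p ((p ^^ a) s) ((p ^^ b) s) ((p ^^ c) s) ((p ^^ d) s))"
    and u_def: "u = Suc c mod n" and v_def: "v = Suc d mod n"
  shows "fwd_res n a v - fwd_res n b v - (fwd_res n a u - fwd_res n b u) =
    2 * (bwd_res n a u - bwd_res n b u - (bwd_res n a v - bwd_res n b v))"
proof -
  obtain pos where pos: "\<And>i. i < n \<Longrightarrow> pos i < n" "\<And>i. i < n \<Longrightarrow> (p ^^ pos i) s = i"
    "\<And>k. k < n \<Longrightarrow> pos ((p ^^ k) s) = k" "\<And>i. i < n \<Longrightarrow> pos (p i) = Suc (pos i) mod n"
    by (rule cyclic_position[OF p cyc s]) blast
  define K :: real where "K = 2 ^ n - 1"
  have "(2 :: real) ^ n > 1"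
    using s by (intro one_less_power) auto
  then have K: "K \<noteq> 0"
    by (simp add: K_def)
  define y where "y i = (fwd_res n a (pos i) - fwd_res n b (pos i)) / K" for i
  define z where "z i = (bwd_res n a (pos i) - bwd_res n b (pos i)) / K" for i
  have e: "(p ^^ k) s < n" for k
    using cyclic_on_funpow_in[OF cyc, of s k] s by simp
  have pos_iff: "i = (p ^^ k) s \<longleftrightarrow> pos i = k" if "i < n" "k < n" for i k
    using pos that by metis
  have eq: "y (p ((p ^^ d) s)) - y (p ((p ^^ c) s)) = 2 * (z (p ((p ^^ c) s)) - z (p ((p ^^ d) s)))"
  proof (rule finite_order_resolvent_identity[OF p e e e e _ _ _ _ fin])
    fix i assume i: "i < n"
    have "2 * y i - y (p i) = ((2 * fwd_res n a (pos i) - fwd_res n a (Suc (pos i) mod n)) -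
        (2 * fwd_res n b (pos i) - fwd_res n b (Suc (pos i) mod n))) / K"
      using i by (simp add: y_def pos(4) diff_divide_distrib)
    also have "\<dots> = (K * of_bool (pos i = a) - K * of_bool (pos i = b)) / K"
      using i lt pos(1) by (simp only: fwd_res_step K_def)
    finally show "2 * y i - y (p i) = of_bool (i = (p ^^ a) s) - of_bool (i = (p ^^ b) s)"
      using K i lt by (simp add: pos_iff diff_divide_distrib)
    have "2 * z (p i) - z i = ((2 * bwd_res n a (Suc (pos i) mod n) - bwd_res n a (pos i)) -
        (2 * bwd_res n b (Suc (pos i) mod n) - bwd_res n b (pos i))) / K"
      using i by (simp add: z_def pos(4) diff_divide_distrib)
    also have "\<dots> = (K * of_bool (pos i = a) - K * of_bool (pos i = b)) / K"
      using i lt pos(1) by (simp only: bwd_res_step K_def)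
    finally show "2 * z (p i) - z i = of_bool (i = (p ^^ a) s) - of_bool (i = (p ^^ b) s)"
      using K i lt by (simp add: pos_iff diff_divide_distrib)
  qed (use pos(3) lt ne in metis)+
  have yz: "K * y i = fwd_res n a (pos i) - fwd_res n b (pos i)"
    "K * z i = bwd_res n a (pos i) - bwd_res n b (pos i)" for i
    using K by (simp_all add: y_def z_def)
  have "pos (p ((p ^^ c) s)) = u" "pos (p ((p ^^ d) s)) = v"
    using pos(3,4) e lt by (simp_all add: u_def v_def)
  then show ?thesis
    using arg_cong[OF eq, of "\<lambda>x. K * x"]
    by (simp only: right_diff_distrib[of K] mult.left_commute[of K 2] yz)
qed

section \<open>Four consecutive points give infinite order\<close>

text \<open>For \<open>n \<ge> 5\<close> the positions \<open>Suc c\<close> and \<open>Suc d\<close>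
  do not wrap around, and every resolvent entry involved is a constant or a constant times
  \<open>t = 2 ^ (n - 5)\<close>. Each arrangement yields a linear relation in \<open>t\<close> that
  fails for all \<open>t \<ge> 1\<close>.\<close>

lemma window_not_finite_order:
  assumes p: "p permutes {..<n :: nat}" and cyc: "cyclic_on p {..<n}" and s: "s < n" and n: "n \<ge> 5"
    and lt: "a < 4" "b < 4" "c < 4" "d < 4" and dist: "distinct [a, b, c, d]"
  shows "\<not> finite_mult_order n
      (pt_mat n p ((p ^^ a) s) ((p ^^ b) s) ((p ^^ c) s) ((p ^^ d) s))"
proof
  assume "finite_mult_order n
      (pt_mat n p ((p ^^ a) s) ((p ^^ b) s) ((p ^^ c) s) ((p ^^ d) s))"
  then have id: "fwd_res n a (Suc d) - fwd_res n b (Suc d) - (fwd_res n a (Suc c) - fwd_res n b (Suc c)) =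
    2 * (bwd_res n a (Suc c) - bwd_res n b (Suc c) - (bwd_res n a (Suc d) - bwd_res n b (Suc d)))"
    using n lt dist by (intro finite_order_position_identity[OF p cyc s]) auto
  obtain r where r: "n = 5 + r"
    using n le_iff_add by blast
  define t :: real where "t = 2 ^ r"
  have t: "t \<ge> 1"
    by (simp add: t_def)
  have f: "fwd_res n m l = (if l \<le> m then 2 ^ (4 - m + l) * t else 2 ^ (l - m - 1))" if "m < 4" for m l
    using that by (auto simp: fwd_res_def r t_def simp flip: power_add)
  have b: "bwd_res n m l = (if l \<le> m then 2 ^ (m - l) else 2 ^ (5 + m - l) * t)" if "m < 4" "l \<le> 4" for m l
    using that by (auto simp: bwd_res_def r t_def simp flip: power_add)
  \<comment> \<open>Membership in an explicit finite set makes \<open>auto\<close> check the 24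
    arrangements one by one.\<close>
  have "(a, b, c, d) \<in> {(a, b, c, d). a \<in> {0, 1, 2, 3} \<and> b \<in> {0, 1, 2, 3} \<and> c \<in> {0, 1, 2, 3} \<and>
      d \<in> {0, 1, 2, 3} \<and> distinct [a, b, c, d]}"
    using lt dist by auto
  then show False
    using id t lt by (auto simp: f b)
qed

text \<open>When \<open>n = 4\<close> the run closes up to the whole cycle. The determinant identity
  rules out every arrangement except those with \<open>pos b = 2\<close>, where it holds; there an
  explicit Jordan chain takes over.\<close>

lemma order_four_not_finite_order:
  assumes p: "p permutes {..<4 :: nat}" and cyc: "cyclic_on p {..<4}"
    and lt: "a < 4" "b < 4" "c < 4" "d < 4" and dist: "distinct [a, b, c, d]"
  shows "\<not> finite_mult_order 4 (pt_mat 4 p a b c d)"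
proof
  assume fin: "finite_mult_order 4 (pt_mat 4 p a b c d)"
  obtain pos where pos: "\<And>i. i < 4 \<Longrightarrow> pos i < 4" "\<And>i. i < 4 \<Longrightarrow> (p ^^ pos i) a = i"
    "\<And>k. k < 4 \<Longrightarrow> pos ((p ^^ k) a) = k" "\<And>i. i < 4 \<Longrightarrow> pos (p i) = Suc (pos i) mod 4"
    by (rule cyclic_position[OF p cyc \<open>a < 4\<close>]) blast
  have pa: "pos a = 0"
    using pos(3)[of 0] by simp
  have pos_inj: "pos i = pos j \<longleftrightarrow> i = j" if "i < 4" "j < 4" for i j
    using pos(2) that by metis
  have "distinct [pos a, pos b, pos c, pos d]"
    using dist lt by (simp add: pos_inj)
  \<comment> \<open>Counting positions from \<open>a\<close> leaves six arrangements of the other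
    three points.\<close>
  then have dist': "distinct [0, pos b, pos c, pos d]"
    by (simp only: pa)
  have "pos b \<in> {0, 1, 2, 3}" "pos c \<in> {0, 1, 2, 3}" "pos d \<in> {0, 1, 2, 3}"
    using pos(1) lt by fastforce+
  note mem = this
  define u where "u = Suc (pos c) mod 4"
  define v where "v = Suc (pos d) mod 4"
  have "fwd_res 4 0 v - fwd_res 4 (pos b) v - (fwd_res 4 0 u - fwd_res 4 (pos b) u) =
    2 * (bwd_res 4 0 u - bwd_res 4 (pos b) u - (bwd_res 4 0 v - bwd_res 4 (pos b) v))"
  proof (rule finite_order_position_identity[OF p cyc \<open>a < 4\<close> _ _ _ _ _ _ _ _ _ u_def v_def])
    show "finite_mult_order 4 (pt_mat 4 p ((p ^^ 0) a) ((p ^^ pos b) a) ((p ^^ pos c) a) ((p ^^ pos d) a))"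
      using fin lt pos(2) by simp
  qed (use dist' pos(1) lt in auto)
  then have b: "pos b = 2"
    using mem dist' unfolding u_def v_def by (auto simp: fwd_res_def bwd_res_def)
  \<comment> \<open>\<open>\<epsilon>\<close> is the eigenvalue: 1 or -1 according to the order of
    \<open>c\<close> and \<open>d\<close> on the cycle. The vectors below, listed by position, form
    the chain: \<open>g\<close> is an eigenvector and \<open>f\<close> a generalized one above
    it.\<close>
  define \<epsilon> :: real where "\<epsilon> = (if pos c = 3 then 1 else -1)"
  define f :: "nat \<Rightarrow> real" where "f i = [1, \<epsilon>, 0, 0] ! pos i" for i
  define g :: "nat \<Rightarrow> real" where "g i = [1, - \<epsilon>, - 1, \<epsilon>] ! pos i" for i
  have cases: "pos c = 3 \<and> pos d = 1 \<and> \<epsilon> = 1 \<or> pos c = 1 \<and> pos d = 3 \<and> \<epsilon> = -1"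
    using mem dist' b by (auto simp: \<epsilon>_def)
  have at: "i = a \<longleftrightarrow> pos i = 0" "i = b \<longleftrightarrow> pos i = 2" if "i < 4" for i
    using pos(2) b pa lt that by metis+
  have posmem: "pos i \<in> {0, 1, 2, 3}" if "i < 4" for i
    using pos(1)[OF that] by auto
  let ?A = "pt_mat 4 p a b c d :: real mat"
  have row: "(?A *\<^sub>v vec 4 h) $ i = h (p i) + (of_bool (pos i = 0) - of_bool (pos i = 2)) * (h (p c) - h (p d))"
    if "i < 4" for h i
    using that lt by (simp only: pt_mat_mult_vec[OF p] at)
  have Af: "?A *\<^sub>v vec 4 f = \<epsilon> \<cdot>\<^sub>v (vec 4 f + vec 4 g)"
  proof (rule eq_vecI)
    fix i assume "i < dim_vec (\<epsilon> \<cdot>\<^sub>v (vec 4 f + vec 4 g))"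
    then have i: "i < 4" by simp
    show "(?A *\<^sub>v vec 4 f) $ i = (\<epsilon> \<cdot>\<^sub>v (vec 4 f + vec 4 g)) $ i"
      using posmem[OF i] cases i lt unfolding row[OF i]
      by (auto simp: f_def g_def pos(4))
  qed (simp add: pt_mat_def)
  have Ag: "?A *\<^sub>v vec 4 g = \<epsilon> \<cdot>\<^sub>v vec 4 g"
  proof (rule eq_vecI)
    fix i assume "i < dim_vec (\<epsilon> \<cdot>\<^sub>v vec 4 g)"
    then have i: "i < 4" by simp
    show "(?A *\<^sub>v vec 4 g) $ i = (\<epsilon> \<cdot>\<^sub>v vec 4 g) $ i"
      using posmem[OF i] cases i lt unfolding row[OF i]
      by (auto simp: g_def pos(4))
  qed (simp add: pt_mat_def)
  obtain k where k: "k > 0" "?A ^\<^sub>m k = 1\<^sub>m 4"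
    using fin by (rule finite_mult_order_pt_mat)
  have "vec 4 g $ a \<noteq> 0\<^sub>v 4 $ a"
    using \<open>a < 4\<close> pa by (simp add: g_def)
  then have "vec 4 g \<noteq> 0\<^sub>v 4"
    by metis
  moreover have "\<epsilon> * \<epsilon> = 1"
    by (simp add: \<epsilon>_def)
  ultimately show False
    using infinite_order_of_growth[OF pt_mat_carrier vec_carrier vec_carrier _ _ Af Ag k(1)] k(2) by blast
qed

section \<open>Nearly invariant sets are runs of the cycle\<close>

text \<open>
  Start at a point of \<open>S\<close> outside \<open>p ` S\<close>. If its orbit left \<open>S\<close> too early, the remaining points of
  \<open>S\<close> would form a proper invariant subset.
\<close>

lemma nearly_invariant_is_run:
  assumes p: "p permutes {..<n :: nat}" and cyc: "cyclic_on p {..<n}"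
    and S: "S \<subseteq> {..<n}" "S \<noteq> {}" and near: "card S \<le> Suc (card (S \<inter> p ` S))"
  obtains s where "s < n" "S = (\<lambda>k. (p ^^ k) s) ` {..<card S}"
proof -
  have fin: "finite S"
    using S finite_subset by blast
  have inj: "inj p"
    using p by (rule permutes_inj)
  \<comment> \<open>A point of \<open>S\<close> outside the image of \<open>S\<close> if there is
    one, otherwise any point; the stated implication covers both cases.\<close>
  obtain s where s: "s \<in> S" and s_out: "s \<in> p ` S \<Longrightarrow> S \<subseteq> p ` S"
    using S(2) by blast
  have "(p ^^ k) s \<in> S" if "k < card S" for k
  proof (rule ccontr)
    assume "(p ^^ k) s \<notin> S"
    define m where "m = (LEAST k. (p ^^ k) s \<notin> S)"
    have m: "(p ^^ m) s \<notin> S"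
      unfolding m_def by (rule LeastI) fact
    have "m \<le> k"
      unfolding m_def by (rule Least_le) fact
    have in_S: "(p ^^ i) s \<in> S" if "i < m" for i
      using not_less_Least that unfolding m_def by blast
    obtain m' where m': "m = Suc m'"
      using m s by (cases m) auto
    \<comment> \<open>The part of the orbit traversed before it leaves \<open>S\<close>. The points
      of \<open>S - F\<close> turn out to be mapped into \<open>S - F\<close>.\<close>
    define F where "F = (\<lambda>i. (p ^^ i) s) ` {..<m}"
    have "card F \<le> m"
      unfolding F_def using card_image_le[of "{..<m}"] by simp
    then have "card F < card S"
      using \<open>m \<le> k\<close> that by simp
    then obtain x0 where x0: "x0 \<in> S - F"
      using card_mono[of F S] unfolding F_def by (metis Diff_iff finite_imageI finite_lessThan leD subsetI)
    have closed: "p x \<in> S - F" if x: "x \<in> S - F" for x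
    proof -
      have "p x \<in> S"
      proof (rule ccontr)
        assume "p x \<notin> S"
        \<comment> \<open>\<open>?l\<close> is the last point of \<open>F\<close>, mapped out of
          \<open>S\<close>. If \<open>x\<close> were too, \<open>S\<close> would lose two points
          under \<open>p\<close>, but \<open>near\<close> allows only one.\<close>
        let ?l = "(p ^^ m') s"
        have "?l \<in> F" "?l \<in> S" "p ?l \<notin> S"
          using in_S[of m'] m by (auto simp: F_def m')
        then have "x \<noteq> ?l"
          using x by blast
        have "S \<inter> p ` S \<subseteq> p ` (S - {x, ?l})"
          using \<open>p x \<notin> S\<close> \<open>p ?l \<notin> S\<close> by auto
        then have "card (S \<inter> p ` S) \<le> card (S - {x, ?l})"
          using fin by (meson card_image_le card_mono finite_Diff finite_imageI le_trans)
        also have "\<dots> = card S - 2"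
          using \<open>x \<noteq> ?l\<close> \<open>?l \<in> S\<close> x fin by (subst card_Diff_subset) auto
        finally show False
          using near card_mono[OF fin, of "{x, ?l}"] \<open>x \<noteq> ?l\<close> \<open>?l \<in> S\<close> x by auto
      qed
      moreover have "p x \<notin> F"
      proof
        assume "p x \<in> F"
        then obtain i where i: "i < m" "p x = (p ^^ i) s"
          by (auto simp: F_def)
        show False
        proof (cases i)
          case 0
          \<comment> \<open>Now \<open>s = p x\<close> lies in the image of \<open>S\<close>, so the
            choice of \<open>s\<close> makes \<open>S\<close> invariant and the orbit of
            \<open>s\<close> never leaves it.\<close>
          then have "S \<subseteq> p ` S"
            using i x s_out by (metis Diff_iff funpow_0 imageI)
          then have "S = p ` S"
            using fin by (intro card_subset_eq) (auto simp: card_image inj_on_subset[OF inj])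
          then have "(p ^^ j) s \<in> S" for j
            using s by (induction j) auto
          then show False
            using m by blast
        next
          case (Suc i')
          then have "x = (p ^^ i') s"
            using i injD[OF inj] by simp
          then show False
            using x i Suc by (auto simp: F_def)
        qed
      qed
      ultimately show ?thesis by blast
    qed
    \<comment> \<open>The single orbit carries membership in \<open>S - F\<close> from
      \<open>x0\<close> to \<open>s\<close>, yet \<open>s\<close> is the first point of
      \<open>F\<close>.\<close>
    have orb: "orbit p x0 = {..<n}"
      using orbit_cyclic_eq3[OF cyc] x0 S by blast
    have "s \<in> orbit p x0"
      using orb s S by blast
    then have "s \<in> S - F"
      by induction (use closed x0 in auto)
    moreover have "s \<in> F"
      unfolding F_def m' by (rule image_eqI[of _ _ 0]) auto
    ultimately show False by blast
  qed
  then have sub: "(\<lambda>k. (p ^^ k) s) ` {..<card S} \<subseteq> S"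
    by blast
  have "s < n"
    using s S by auto
  moreover have "card S \<le> n"
    using card_mono[OF _ S(1)] by simp
  ultimately have "inj_on (\<lambda>k. (p ^^ k) s) {..<card S}"
    using cyclic_on_enum(1)[OF p cyc] by (auto simp: bij_betw_def intro: inj_on_subset)
  then have "(\<lambda>k. (p ^^ k) s) ` {..<card S} = S"
    by (intro card_subset_eq[OF fin sub]) (simp add: card_image)
  then show ?thesis
    using that \<open>s < n\<close> by metis
qed

section \<open>Reordering the indices along two chains\<close>

text \<open>Give \<open>x i\<close> the key \<open>i\<close> and \<open>y j\<close> an affine key
  \<open>\<alpha> + \<beta> * j\<close>. Up to two common points can be matched by such a map with
  \<open>\<beta> \<noteq> 0\<close>, and the sign of \<open>\<beta>\<close> decides the direction of
  the second chain.\<close>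

lemma exists_key_for_two_chains:
  fixes x y :: "nat \<Rightarrow> 'a"
  assumes x: "inj_on x {..<m}" and y: "inj_on y {..<l}"
    and common: "card (x ` {..<m} \<inter> y ` {..<l}) \<le> 2"
  obtains \<rho> :: "'a \<Rightarrow> real" where
    "\<And>i j. i < j \<Longrightarrow> j < m \<Longrightarrow> \<rho> (x i) < \<rho> (x j)"
    "(\<forall>i j. i < j \<and> j < l \<longrightarrow> \<rho> (y i) < \<rho> (y j)) \<or> (\<forall>i j. i < j \<and> j < l \<longrightarrow> \<rho> (y j) < \<rho> (y i))"
proof -
  let ?C = "x ` {..<m} \<inter> y ` {..<l}"
  have x_iff: "x i = x j \<longleftrightarrow> i = j" if "i < m" "j < m" for i j
    using x that by (auto dest: inj_onD)
  have y_iff: "y i = y j \<longleftrightarrow> i = j" if "i < l" "j < l" for i j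
    using y that by (auto dest: inj_onD)
  have "finite ?C" by simp
  moreover have "card ?C = 0 \<or> card ?C = 1 \<or> card ?C = 2"
    using common by linarith
  ultimately consider "?C = {}" | w where "?C = {w}" | v w where "v \<noteq> w" "?C = {v, w}"
    by (metis card_0_eq card_1_singletonE card_2_iff)
  then have "\<exists>\<alpha> \<beta> :: real. \<beta> \<noteq> 0 \<and> (\<forall>i<m. \<forall>j<l. x i = y j \<longrightarrow> real i = \<alpha> + \<beta> * real j)"
  proof cases
    case 1
    then have "x i \<noteq> y j" if "i < m" "j < l" for i j
      using that by auto
    then show ?thesis
      by (intro exI[of _ 0] exI[of _ 1]) auto
  next
    case (2 w)
    then have "w \<in> ?C" by simp
    then obtain i0 j0 where w: "w = x i0" "w = y j0" "i0 < m" "j0 < l"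
      by (metis IntE imageE lessThan_iff)
    have "i = i0 \<and> j = j0" if "i < m" "j < l" "x i = y j" for i j
    proof -
      have "x i \<in> ?C"
        using that by (metis IntI image_eqI lessThan_iff)
      then have "x i = w"
        unfolding 2 by (rule singletonD)
      then have "x i = x i0" "y j = y j0"
        using w(1,2) that(3) by metis+
      then show ?thesis
        using x_iff[OF that(1) w(3)] y_iff[OF that(2) w(4)] by blast
    qed
    then show ?thesis
      by (intro exI[of _ "real i0 - real j0"] exI[of _ 1]) auto
  next
    case (3 v w)
    have "v \<in> ?C" "w \<in> ?C"
      unfolding 3(2) by auto
    obtain i0 j0 where v: "v = x i0" "v = y j0" "i0 < m" "j0 < l"
      using \<open>v \<in> ?C\<close> by (metis IntE imageE lessThan_iff)
    obtain i1 j1 where w: "w = x i1" "w = y j1" "i1 < m" "j1 < l"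
      using \<open>w \<in> ?C\<close> by (metis IntE imageE lessThan_iff)
    have ne: "i0 \<noteq> i1" "j0 \<noteq> j1"
      using 3(1) v(1,2) w(1,2) by metis+
    \<comment> \<open>Slope of the line through \<open>(j0, i0)\<close> and \<open>(j1, i1)\<close>;
      it is non-zero, with non-zero denominator, because the two common points differ.\<close>
    define \<beta> where "\<beta> = (real i1 - real i0) / (real j1 - real j0)"
    have "(i = i0 \<and> j = j0) \<or> (i = i1 \<and> j = j1)" if "i < m" "j < l" "x i = y j" for i j
    proof -
      have "x i \<in> ?C"
        using that by (metis IntI image_eqI lessThan_iff)
      then have "x i = v \<or> x i = w"
        unfolding 3(2) by blast
      then have "x i = x i0 \<and> y j = y j0 \<or> x i = x i1 \<and> y j = y j1"
        using v(1,2) w(1,2) that(3) by metis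
      then show ?thesis
        using x_iff[OF that(1) v(3)] y_iff[OF that(2) v(4)]
          x_iff[OF that(1) w(3)] y_iff[OF that(2) w(4)] by blast
    qed
    moreover have "\<beta> * (real j1 - real j0) = real i1 - real i0" "\<beta> \<noteq> 0"
      using ne by (simp_all add: \<beta>_def)
    then have "\<beta> \<noteq> 0" "real i1 = real i0 - \<beta> * real j0 + \<beta> * real j1"
      by (simp_all add: algebra_simps)
    ultimately have "\<beta> \<noteq> 0 \<and> (\<forall>i<m. \<forall>j<l. x i = y j \<longrightarrow>
        real i = (real i0 - \<beta> * real j0) + \<beta> * real j)"
      by force
    then show ?thesis
      by blast
  qed
  then obtain \<alpha> \<beta> :: real where \<beta>: "\<beta> \<noteq> 0"
    and agree: "\<And>i j. i < m \<Longrightarrow> j < l \<Longrightarrow> x i = y j \<Longrightarrow> real i = \<alpha> + \<beta> * real j"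
    by blast
  \<comment> \<open>\<open>agree\<close> makes the two formulas coincide on common points; off both
    chains the key is arbitrary.\<close>
  define \<rho> where "\<rho> w = (if w \<in> x ` {..<m} then real (inv_into {..<m} x w)
    else \<alpha> + \<beta> * real (inv_into {..<l} y w))" for w
  have \<rho>x: "\<rho> (x i) = real i" if "i < m" for i
    using that x by (simp add: \<rho>_def)
  have \<rho>y: "\<rho> (y j) = \<alpha> + \<beta> * real j" if "j < l" for j
  proof (cases "y j \<in> x ` {..<m}")
    case True
    then show ?thesis
      using agree[OF _ that] \<rho>x by fastforce
  qed (use that y in \<open>simp add: \<rho>_def\<close>)
  show ?thesis
  proof
    show "\<rho> (x i) < \<rho> (x j)" if "i < j" "j < m" for i j
      using that by (simp add: \<rho>x)
    show "(\<forall>i j. i < j \<and> j < l \<longrightarrow> \<rho> (y i) < \<rho> (y j)) \<or> (\<forall>i j. i < j \<and> j < l \<longrightarrow> \<rho> (y j) < \<rho> (y i))"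
      using \<beta> by (cases "\<beta> > 0") (auto simp: \<rho>y)
  qed
qed

text \<open>\<open>\<sigma> i\<close> is the rank of \<open>i\<close>, the number of indices before
  it. Breaking ties of \<open>\<rho>\<close> by the index itself makes the order total, so the ranks
  are distinct.\<close>

lemma exists_sorting_permutation:
  fixes \<rho> :: "nat \<Rightarrow> 'a :: linorder"
  obtains \<sigma> where "\<sigma> permutes {..<n}" "\<And>i j. i < n \<Longrightarrow> j < n \<Longrightarrow> \<rho> i < \<rho> j \<Longrightarrow> \<sigma> i < \<sigma> j"
proof -
  define less where "less i j \<longleftrightarrow> \<rho> i < \<rho> j \<or> \<rho> i = \<rho> j \<and> i < j" for i j
  define below where "below i = {j. j < n \<and> less j i}" for i
  define \<sigma> where "\<sigma> i = (if i < n then card (below i) else i)" for i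
  have fin: "finite (below i)" for i
    by (simp add: below_def)
  have mono: "\<sigma> i < \<sigma> j" if "i < n" "j < n" "less i j" for i j
  proof -
    have "below i \<subset> below j"
      using that by (auto simp: below_def less_def)
    then show ?thesis
      using that fin by (simp add: \<sigma>_def psubset_card_mono)
  qed
  have "inj_on \<sigma> {..<n}"
  proof (rule inj_onI, rule ccontr)
    fix i j
    assume *: "i \<in> {..<n}" "j \<in> {..<n}" "\<sigma> i = \<sigma> j" "i \<noteq> j"
    then have "less i j \<or> less j i"
      unfolding less_def by fastforce
    then show False
      using mono[of i j] mono[of j i] * by auto
  qed
  moreover have "\<sigma> ` {..<n} \<subseteq> {..<n}"
  proof clarsimp
    fix i assume "i < n"
    then have "below i \<subset> {..<n}"
      by (auto simp: below_def less_def)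
    then show "\<sigma> i < n"
      using psubset_card_mono[of "{..<n}" "below i"] \<open>i < n\<close> by (simp add: \<sigma>_def)
  qed
  ultimately have "bij_betw \<sigma> {..<n} {..<n}"
    by (simp add: bij_betw_def endo_inj_surj)
  then have "\<sigma> permutes {..<n}"
    by (rule bij_imp_permutes) (simp add: \<sigma>_def)
  with mono that show ?thesis
    by (simp add: less_def)
qed

section \<open>Alternating lines and simultaneous reordering of rows and columns\<close>

lemma filter_upt_eq_sorted_list:
  assumes "sorted_wrt (<) ks" "set ks = {i. i < n \<and> P i}"
  shows "filter P [0..<n] = ks"
proof (rule sorted_distinct_set_unique)
  show "sorted ks" "distinct ks"
    using assms(1) unfolding strict_sorted_iff by blast+
  show "sorted (filter P [0..<n])"
    by (rule sorted_wrt_filter) simp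
  show "set (filter P [0..<n]) = set ks"
    unfolding assms(2) by (simp add: Collect_conj_eq atLeast0LessThan lessThan_def)
qed simp

lemma alternating_line_single:
  assumes "k < n"
  shows "alternating_line (vec n (\<lambda>i. of_bool (i = k)))"
proof -
  have "filter (\<lambda>i. i = k) [0..<n] = [k]"
    using assms by (intro filter_upt_eq_sorted_list) auto
  then show ?thesis
    by (simp add: alternating_line_def filter_map o_def)
qed

text \<open>The sign pattern \<open>1, -1, 1\<close> reads the same backwards, which is why both
  directions are allowed.\<close>

lemma alternating_line_triple:
  assumes "k1 < k2 \<and> k2 < k3 \<or> k3 < k2 \<and> k2 < k1" "k1 < n" "k3 < n"
  shows "alternating_line (vec n (\<lambda>i. of_bool (i = k1) - of_bool (i = k2) + of_bool (i = k3)))"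
    (is "alternating_line (vec n ?f)")
proof -
  have *: "alternating_line (vec n (\<lambda>i. of_bool (i = l1) - of_bool (i = l2) + of_bool (i = l3)))"
    if "l1 < l2" "l2 < l3" "l3 < n" for l1 l2 l3
  proof -
    have nz: "(of_bool (i = l1) - of_bool (i = l2) + of_bool (i = l3) :: int) \<noteq> 0 \<longleftrightarrow>
        i = l1 \<or> i = l2 \<or> i = l3" for i
      using that by auto
    have "filter (\<lambda>i. i = l1 \<or> i = l2 \<or> i = l3) [0..<n] = [l1, l2, l3]"
      using that by (intro filter_upt_eq_sorted_list) auto
    then show ?thesis
      using that by (simp add: alternating_line_def filter_map o_def nz)
  qed
  have "?f = (\<lambda>i. of_bool (i = k3) - of_bool (i = k2) + of_bool (i = k1))"
    by auto
  then show ?thesis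
    using assms *[of k1 k2 k3] *[of k3 k2 k1] by auto
qed

text \<open>Conjugation moves the old index \<open>k\<close> to the place \<open>\<sigma> k\<close>,
  so positions of entries are compared through \<open>\<sigma>\<close>.\<close>

lemma conjugate_perm_mat:
  assumes \<sigma>: "\<sigma> permutes {..<n}" and A: "A \<in> carrier_mat n n"
  shows "transpose_mat (perm_mat n \<sigma>) * A * perm_mat n \<sigma> =
    mat n n (\<lambda>(i, j). A $$ (Hilbert_Choice.inv \<sigma> i, Hilbert_Choice.inv \<sigma> j))" (is "?L = mat n n ?B")
proof (rule eq_matI)
  let ?\<tau> = "Hilbert_Choice.inv \<sigma>"
  fix i j
  assume "i < dim_row (mat n n ?B)" "j < dim_col (mat n n ?B)"
  then have ij: "i < n" "j < n" by auto
  have lt: "?\<tau> k < n" if "k < n" for k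
    using permutes_in_image[OF permutes_inv[OF \<sigma>], of k] that by simp
  have R: "perm_mat n \<sigma> \<in> carrier_mat n n"
    by (simp add: perm_mat_def)
  have entry: "perm_mat n \<sigma> $$ (k, i) = of_bool (k = ?\<tau> i)" if "k < n" "i < n" for k i
    using that by (auto simp: perm_mat_def permutes_inverses[OF \<sigma>])
  have del: "(\<Sum>k<n. of_bool (k = k0) * f k) = f k0" "(\<Sum>k<n. f k * of_bool (k = k0)) = f k0"
    if "k0 < n" for k0 and f :: "nat \<Rightarrow> int"
    using that by (simp_all add: of_bool_def if_distrib[of "\<lambda>x. x * _"] if_distrib[of "\<lambda>x. _ * x"] cong: if_cong)
  define X where "X = transpose_mat (perm_mat n \<sigma>) * A"
  have X: "X \<in> carrier_mat n n"
    using A R by (simp add: X_def)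
  have row: "X $$ (i, l) = A $$ (?\<tau> i, l)" if "l < n" for l
  proof -
    have "X $$ (i, l) = (\<Sum>k<n. of_bool (k = ?\<tau> i) * A $$ (k, l))"
      using ij that A R by (simp add: X_def scalar_prod_def lessThan_atLeast0 entry)
    then show ?thesis
      using lt[OF ij(1)] by (simp only: del)
  qed
  have "?L $$ (i, j) = (\<Sum>l<n. X $$ (i, l) * of_bool (l = ?\<tau> j))"
    unfolding X_def[symmetric] using ij X R by (simp add: scalar_prod_def lessThan_atLeast0 entry)
  also have "\<dots> = (\<Sum>l<n. A $$ (?\<tau> i, l) * of_bool (l = ?\<tau> j))"
    by (intro sum.cong) (simp_all only: row lessThan_iff)
  finally show "?L $$ (i, j) = mat n n ?B $$ (i, j)"
    using ij lt[OF ij(2)] by (simp only: del) simp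
qed (use A in \<open>auto simp: perm_mat_def\<close>)

text \<open>Disjointness says that \<open>p a\<close> and \<open>p b\<close> avoid both block
  columns; pulling the columns back along \<open>p\<close> yields four distinct indices.\<close>

lemma PT_matrix_type1_pt_mat:
  assumes "PT_matrix_type1 n A"
  obtains p a b c d where "p permutes {..<n}" "cyclic_on p {..<n}"
    "a < n" "b < n" "c < n" "d < n" "distinct [a, b, c, d]" "A = pt_mat n p a b c d"
proof -
  from assms obtain p a j1 b j2 where p: "p permutes {..<n}" "cyclic_on p {..<n}"
    and lt: "a < n" "j1 < n" "b < n" "j2 < n" and ne: "a \<noteq> b" "j1 \<noteq> j2"
    and disj: "\<And>i j. i < n \<Longrightarrow> j < n \<Longrightarrow> T_block n a j1 b j2 $$ (i, j) \<noteq> 0 \<Longrightarrow> perm_mat n p $$ (i, j) \<noteq> 1"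
    and A: "A = perm_mat n p + T_block n a j1 b j2"
    unfolding PT_matrix_type1_def is_n_cycle_mat_def is_T_block_def by blast
  let ?q = "Hilbert_Choice.inv p"
  have pq: "p (?q j) = j" for j
    using permutes_inverses[OF p(1)] by simp
  have q_lt: "?q j < n" if "j < n" for j
    using permutes_in_image[OF permutes_inv[OF p(1)], of j] that by simp
  have "p a \<noteq> j1" "p a \<noteq> j2" "p b \<noteq> j1" "p b \<noteq> j2"
    using disj[of a j1] disj[of a j2] disj[of b j1] disj[of b j2] lt ne
    by (auto simp: T_block_def perm_mat_def)
  then have "distinct [a, b, ?q j1, ?q j2]"
    using ne pq by (auto; metis)
  moreover have "A = pt_mat n p a b (?q j1) (?q j2)"
  proof (rule eq_matI)
    fix i j
    assume "i < dim_row (pt_mat n p a b (?q j1) (?q j2) :: int mat)"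
      "j < dim_col (pt_mat n p a b (?q j1) (?q j2) :: int mat)"
    then show "A $$ (i, j) = pt_mat n p a b (?q j1) (?q j2) $$ (i, j)"
      unfolding A pt_mat_def T_block_def perm_mat_def using ne
      by (cases "i = a"; cases "i = b"; cases "j = j1"; cases "j = j2") (simp_all add: pq)
  qed (simp_all add: A pt_mat_def T_block_def perm_mat_def)
  ultimately show ?thesis
    by (rule that[OF p lt(1,3) q_lt[OF lt(2)] q_lt[OF lt(4)]])
qed

text \<open>Only four lines have more than one non-zero entry: row \<open>a\<close> at
  \<open>p c, p d, p a\<close>, row \<open>b\<close> at \<open>p b, p c, p d\<close>, column
  \<open>p c\<close> at \<open>a, b, c\<close> and column \<open>p d\<close> at
  \<open>d, a, b\<close>, each listed with its -1 in the middle. The two chains keep these middle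
  entries in the middle.\<close>

lemma alternating_sign_matrix_reordered_pt_mat:
  assumes p: "p permutes {..<n}" and \<sigma>: "\<sigma> permutes {..<n}"
    and lt: "a < n" "b < n" "c < n" "d < n" and dist: "distinct [a, b, c, d]"
    and cols: "\<sigma> d < \<sigma> a" "\<sigma> a < \<sigma> b" "\<sigma> b < \<sigma> c"
    and rows: "\<sigma> (p b) < \<sigma> (p c) \<and> \<sigma> (p c) < \<sigma> (p d) \<and> \<sigma> (p d) < \<sigma> (p a) \<or>
      \<sigma> (p a) < \<sigma> (p d) \<and> \<sigma> (p d) < \<sigma> (p c) \<and> \<sigma> (p c) < \<sigma> (p b)"
  shows "alternating_sign_matrix n
    (mat n n (\<lambda>(i, j). pt_mat n p a b c d $$ (Hilbert_Choice.inv \<sigma> i, Hilbert_Choice.inv \<sigma> j)))"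
    (is "alternating_sign_matrix n ?B")
proof -
  let ?\<tau> = "Hilbert_Choice.inv \<sigma>" and ?q = "Hilbert_Choice.inv p"
  have p_lt: "p k < n" if "k < n" for k
    using permutes_in_image[OF p, of k] that by simp
  have \<sigma>_lt: "\<sigma> k < n" if "k < n" for k
    using permutes_in_image[OF \<sigma>, of k] that by simp
  have \<tau>_lt: "?\<tau> k < n" if "k < n" for k
    using permutes_in_image[OF permutes_inv[OF \<sigma>], of k] that by simp
  have q_lt: "?q k < n" if "k < n" for k
    using permutes_in_image[OF permutes_inv[OF p], of k] that by simp
  have p_iff: "p i = p j \<longleftrightarrow> i = j" for i j
    using permutes_inj[OF p] by (auto dest: injD)
  have \<tau>_iff: "?\<tau> j = w \<longleftrightarrow> j = \<sigma> w" for j w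
    using permutes_inverses[OF \<sigma>] by metis
  have entries: "?B $$ (i, j) \<in> {0, 1, -1}" if "i < n" "j < n" for i j
    using that dist \<tau>_lt by (auto simp: pt_mat_def p_iff)
  have row: "alternating_line (row ?B i)" if i: "i < n" for i
  proof -
    define r where "r = ?\<tau> i"
    have r: "r < n"
      using \<tau>_lt[OF i] by (simp add: r_def)
    have row_i: "row ?B i = vec n (\<lambda>j. of_bool (j = \<sigma> (p r)) +
        (of_bool (r = a) - of_bool (r = b)) * (of_bool (j = \<sigma> (p c)) - of_bool (j = \<sigma> (p d))))"
      using i r \<tau>_lt by (intro eq_vecI) (simp_all add: pt_mat_def \<tau>_iff r_def[symmetric])
    consider "r = a" | "r = b" | "r \<noteq> a" "r \<noteq> b" by blast
    then show ?thesis
    proof cases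
      case 1
      then have "row ?B i = vec n (\<lambda>j. of_bool (j = \<sigma> (p c)) - of_bool (j = \<sigma> (p d)) + of_bool (j = \<sigma> (p a)))"
        unfolding row_i using dist by (intro eq_vecI) auto
      then show ?thesis
        using rows lt by (simp only:) (intro alternating_line_triple, auto intro: \<sigma>_lt p_lt)
    next
      case 2
      then have "row ?B i = vec n (\<lambda>j. of_bool (j = \<sigma> (p b)) - of_bool (j = \<sigma> (p c)) + of_bool (j = \<sigma> (p d)))"
        unfolding row_i using dist by (intro eq_vecI) auto
      then show ?thesis
        using rows lt by (simp only:) (intro alternating_line_triple, auto intro: \<sigma>_lt p_lt)
    next
      case 3
      then have "row ?B i = vec n (\<lambda>j. of_bool (j = \<sigma> (p r)))"
        unfolding row_i by (intro eq_vecI) auto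
      then show ?thesis
        using r by (simp only:) (intro alternating_line_single \<sigma>_lt p_lt)
    qed
  qed
  have col: "alternating_line (col ?B j)" if j: "j < n" for j
  proof -
    \<comment> \<open>\<open>r\<close> is the row in which the permutation matrix has its 1 in
      column \<open>?\<tau> j\<close>.\<close>
    define r where "r = ?q (?\<tau> j)"
    have r: "r < n" "?\<tau> j = p r"
      using q_lt[OF \<tau>_lt[OF j]] permutes_inverses[OF p] by (simp_all add: r_def)
    have col_j: "col ?B j = vec n (\<lambda>i. of_bool (i = \<sigma> r) +
        (of_bool (i = \<sigma> a) - of_bool (i = \<sigma> b)) * (of_bool (r = c) - of_bool (r = d)))"
      using j r(1) \<tau>_lt p_lt
      by (intro eq_vecI) (simp_all add: pt_mat_def \<tau>_iff r(2) p_iff eq_commute[of r])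
    consider "r = c" | "r = d" | "r \<noteq> c" "r \<noteq> d" by blast
    then show ?thesis
    proof cases
      case 1
      then have "col ?B j = vec n (\<lambda>i. of_bool (i = \<sigma> a) - of_bool (i = \<sigma> b) + of_bool (i = \<sigma> c))"
        unfolding col_j using dist by (intro eq_vecI) auto
      then show ?thesis
        using cols lt by (simp only:) (intro alternating_line_triple, auto intro: \<sigma>_lt)
    next
      case 2
      then have "col ?B j = vec n (\<lambda>i. of_bool (i = \<sigma> d) - of_bool (i = \<sigma> a) + of_bool (i = \<sigma> b))"
        unfolding col_j using dist by (intro eq_vecI) auto
      then show ?thesis
        using cols lt by (simp only:) (intro alternating_line_triple, auto intro: \<sigma>_lt)
    next
      case 3
      then have "col ?B j = vec n (\<lambda>i. of_bool (i = \<sigma> r))"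
        unfolding col_j by (intro eq_vecI) auto
      then show ?thesis
        using r by (simp only:) (intro alternating_line_single \<sigma>_lt)
    qed
  qed
  show ?thesis
    unfolding alternating_sign_matrix_def using entries row col by auto
qed

text \<open>Three common points would make \<open>{a, b, c, d}\<close> a run of four consecutive
  points, and the matrix then has infinite order, whether the run closes up (\<open>n = 4\<close>)
  or not.\<close>

lemma finite_order_common_at_most_two:
  assumes p: "p permutes {..<n :: nat}" and cyc: "cyclic_on p {..<n}"
    and lt: "a < n" "b < n" "c < n" "d < n" and dist: "distinct [a, b, c, d]"
    and fin: "finite_mult_order n (pt_mat n p a b c d)"
  shows "card ({a, b, c, d} \<inter> p ` {a, b, c, d}) \<le> 2"
proof (rule ccontr)
  let ?S = "{a, b, c, d}"
  assume *: "\<not> card (?S \<inter> p ` ?S) \<le> 2"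
  have S: "?S \<subseteq> {..<n}" "?S \<noteq> {}" "card ?S = 4"
    using lt dist by auto
  then have "n \<ge> 4"
    using card_mono[OF _ S(1)] by simp
  have "card ?S \<le> Suc (card (?S \<inter> p ` ?S))"
    using * S(3) by linarith
  from nearly_invariant_is_run[OF p cyc S(1,2) this] obtain s where
    s: "s < n" and run: "?S = (\<lambda>k. (p ^^ k) s) ` {..<4}"
    using S(3) by metis
  show False
  proof (cases "n = 4")
    case True
    then show ?thesis
      using order_four_not_finite_order[of p a b c d] p cyc lt dist fin by simp
  next
    case False
    have "a \<in> ?S" "b \<in> ?S" "c \<in> ?S" "d \<in> ?S" by auto
    then obtain a' b' c' d' where "a' < 4" "b' < 4" "c' < 4" "d' < 4"
      "a = (p ^^ a') s" "b = (p ^^ b') s" "c = (p ^^ c') s" "d = (p ^^ d') s"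
      unfolding run by auto
    then show ?thesis
      using window_not_finite_order[OF p cyc s, of a' b' c' d'] \<open>n \<ge> 4\<close> False dist fin by auto
  qed
qed

theorem theorem5p1:
  fixes n :: nat and A :: "int mat"
  assumes "PT_matrix_type1 n A"
    and "finite_mult_order n A"
  shows "\<exists>B. alternating_sign_matrix n B \<and> permutation_similar n A B"
proof -
  obtain p a b c d where p: "p permutes {..<n}" and cyc: "cyclic_on p {..<n}"
    and lt: "a < n" "b < n" "c < n" "d < n" and dist: "distinct [a, b, c, d]"
    and A: "A = pt_mat n p a b c d"
    using assms(1) by (rule PT_matrix_type1_pt_mat)
  have p_lt: "p k < n" if "k < n" for k
    using permutes_in_image[OF p, of k] that by simp
  have p_iff: "p i = p j \<longleftrightarrow> i = j" for i j
    using permutes_inj[OF p] by (auto dest: injD)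
  \<comment> \<open>\<open>x\<close> lists the order that the columns of the block need, and
    \<open>y\<close> the order that its rows need.\<close>
  define x where "x k = [d, a, b, c] ! k" for k
  define y where "y k = [p b, p c, p d, p a] ! k" for k
  have images: "x ` {..<4} = {a, b, c, d}" "y ` {..<4} = p ` {a, b, c, d}"
    by (auto simp: x_def y_def numeral_eq_Suc lessThan_Suc)
  have "inj_on x {..<4}" "inj_on y {..<4}"
    using dist by (auto simp: x_def y_def numeral_eq_Suc lessThan_Suc p_iff)
  moreover have "card (x ` {..<4} \<inter> y ` {..<4}) \<le> 2"
    unfolding images using finite_order_common_at_most_two[OF p cyc lt dist] assms(2) A by simp
  ultimately obtain \<rho> :: "nat \<Rightarrow> real" where \<rho>x: "\<And>i j. i < j \<Longrightarrow> j < 4 \<Longrightarrow> \<rho> (x i) < \<rho> (x j)" and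
    \<rho>y: "(\<forall>i j. i < j \<and> j < 4 \<longrightarrow> \<rho> (y i) < \<rho> (y j)) \<or> (\<forall>i j. i < j \<and> j < 4 \<longrightarrow> \<rho> (y j) < \<rho> (y i))"
    by (rule exists_key_for_two_chains) blast
  obtain \<sigma> where \<sigma>: "\<sigma> permutes {..<n}"
    and mono: "\<And>i j. i < n \<Longrightarrow> j < n \<Longrightarrow> \<rho> i < \<rho> j \<Longrightarrow> \<sigma> i < \<sigma> j"
    using exists_sorting_permutation[of n \<rho>] by metis
  have "\<rho> d < \<rho> a" "\<rho> a < \<rho> b" "\<rho> b < \<rho> c"
    using \<rho>x[of 0 1] \<rho>x[of 1 2] \<rho>x[of 2 3] by (simp_all add: x_def)
  then have cols: "\<sigma> d < \<sigma> a" "\<sigma> a < \<sigma> b" "\<sigma> b < \<sigma> c"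
    using mono lt by simp_all
  have "\<rho> (p b) < \<rho> (p c) \<and> \<rho> (p c) < \<rho> (p d) \<and> \<rho> (p d) < \<rho> (p a) \<or>
      \<rho> (p a) < \<rho> (p d) \<and> \<rho> (p d) < \<rho> (p c) \<and> \<rho> (p c) < \<rho> (p b)"
    using \<rho>y
  proof
    assume *: "\<forall>i j. i < j \<and> j < 4 \<longrightarrow> \<rho> (y i) < \<rho> (y j)"
    show ?thesis
      using *[rule_format, of 0 1] *[rule_format, of 1 2] *[rule_format, of 2 3] by (simp add: y_def)
  next
    assume *: "\<forall>i j. i < j \<and> j < 4 \<longrightarrow> \<rho> (y j) < \<rho> (y i)"
    show ?thesis
      using *[rule_format, of 0 1] *[rule_format, of 1 2] *[rule_format, of 2 3] by (simp add: y_def)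
  qed
  then have rows: "\<sigma> (p b) < \<sigma> (p c) \<and> \<sigma> (p c) < \<sigma> (p d) \<and> \<sigma> (p d) < \<sigma> (p a) \<or>
      \<sigma> (p a) < \<sigma> (p d) \<and> \<sigma> (p d) < \<sigma> (p c) \<and> \<sigma> (p c) < \<sigma> (p b)"
    using mono lt p_lt by meson
  let ?B = "mat n n (\<lambda>(i, j). A $$ (Hilbert_Choice.inv \<sigma> i, Hilbert_Choice.inv \<sigma> j))"
  have "alternating_sign_matrix n ?B"
    unfolding A by (rule alternating_sign_matrix_reordered_pt_mat[OF p \<sigma> lt dist cols rows])
  moreover have "permutation_similar n A ?B"
    unfolding permutation_similar_def is_permutation_mat_def
    using conjugate_perm_mat[OF \<sigma>, of A] \<sigma> A by (metis pt_mat_carrier)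
  ultimately show ?thesis by blast
qed

end
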